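(* Let $n\ge 1$ and $k\ge 3$ be integers. For a generic tensor $\mathcal A\in\otimes^k\mathbb C^n$, each eigenvector of $\mathcal A$ is nondegenerate. That is, there exists a proper Zariski closed subset $X\subset\otimes^k\mathbb C^n$ such that for every $\mathcal A\notin X$ each eigenvector of $\mathcal A$ is nondegenerate.
   Context: $\otimes^k\mathbb C^n$ is the space of complex (not necessarily symmetric) tensors $\mathcal A=(a_{i_1\dots i_k})$ of order $k$ and dimension $n\times\dots\times n$. For $\mathbf x\in\mathbb C^n$, $\mathcal A\mathbf x^{k-1}\in\mathbb C^n$ is the vector with $i$th component $\sum_{i_2,\dots,i_k=1}^n a_{ii_2\dots i_k}x_{i_2}\cdots x_{i_k}$, and $\mathbf x^{[k-1]}\in\mathbb C^n$ is the vector with components $x_i^{k-1}$. If a nonzero vector $\mathbf x\in\mathbb C^n$ and a number $\lambda\in\mathbb C$ satisfy \[ \mathcal A\mathbf x^{k-1}=\lambda\mathbf x^{[k-1]}, \] then $\lambda$ is an eigenvalue of $\mathcal A$ and $\mathbf x$ is a corresponding eigenvector of $\mathcal A$. An eigenvector $\mathbf x$ of $\mathcal A$ with corresponding eigenvalue $\lambda$ is nondegenerate if the $n\times n$ Jacobian matrix at $\mathbf x$ of the system $\mathcal A\mathbf x^{k-1}-\lambda\mathbf x^{[k-1]}=\mathbf 0$ (differentiated with respect to $\mathbf x$, with $\lambda$ fixed) has rank $n-1$; equivalently, it is singular only along the eigenvector $\mathbf x$ (its kernel is $\mathbb C\mathbf x$). A property is generic in a space $\mathbb F^N$ ($\mathbb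 F=\mathbb R$ or $\mathbb C$) if there is a proper Zariski closed subset $X\subset\mathbb F^N$ such that the property holds outside $X$. *)

theory Defs
  imports "HOL-Analysis.Analysis" "HOL-Library.Poly_Mapping"
begin

section \<open>Zariski closed sets and generic properties\<close>

text \<open>
  Polynomials in variables from \<open>'v\<close> are elements of the ring
  \<open>('v \<Rightarrow>\<^sub>0 nat) \<Rightarrow>\<^sub>0 'a\<close>: a monomial is the finitely supported map of its
  exponents, a polynomial is the finitely supported map of its coefficients.
\<close>

type_synonym ('v, 'a) mpolynomial = "('v \<Rightarrow>\<^sub>0 nat) \<Rightarrow>\<^sub>0 'a"

definition mpoly_vars :: "('v, 'a::zero) mpolynomial \<Rightarrow> 'v set" where
  "mpoly_vars p = (\<Union>m \<in> Poly_Mapping.keys p. Poly_Mapping.keys m)"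

definition mpoly_eval :: "('v, 'a::comm_semiring_1) mpolynomial \<Rightarrow> ('v \<Rightarrow> 'a) \<Rightarrow> 'a" where
  "mpoly_eval p a =
     (\<Sum>m \<in> Poly_Mapping.keys p. Poly_Mapping.lookup p m *
        (\<Prod>v \<in> Poly_Mapping.keys m. a v ^ Poly_Mapping.lookup m v))"

text \<open>
  The affine space with coordinates indexed by \<open>I\<close> consists of the functions on \<open>I\<close>,
  made unique as HOL functions by extensionality outside \<open>I\<close>.
\<close>

definition affine_space :: "'v set \<Rightarrow> ('v \<Rightarrow> 'a) set" where
  "affine_space I = (I \<rightarrow>\<^sub>E UNIV)"

definition zariski_closed :: "'v set \<Rightarrow> ('v \<Rightarrow> 'a::field) set \<Rightarrow> bool" where
  "zariski_closed I X \<longleftrightarrow>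
     (\<exists>S. (\<forall>p \<in> S. mpoly_vars p \<subseteq> I) \<and>
          X = {a \<in> affine_space I. \<forall>p \<in> S. mpoly_eval p a = 0})"

definition generic :: "'v set \<Rightarrow> (('v \<Rightarrow> 'a::field) \<Rightarrow> bool) \<Rightarrow> bool" where
  "generic I P \<longleftrightarrow>
     (\<exists>X. zariski_closed I X \<and> X \<subset> affine_space I \<and> (\<forall>a \<in> affine_space I - X. P a))"

section \<open>Tensors and their eigenvectors\<close>

text \<open>
  An index \<open>(i\<^sub>1, \<dots>, i\<^sub>k)\<close> is a list of length \<open>k\<close> over a finite type \<open>'n\<close> whose
  cardinality is the dimension \<open>n\<close>; the tensors of order \<open>k\<close> form
  \<open>affine_space (multi_indices k)\<close>.
\<close>

definition multi_indices :: "nat \<Rightarrow> 'n list set" where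
  "multi_indices k = {idx. length idx = k}"

definition tensor_apply :: "nat \<Rightarrow> ('n::finite list \<Rightarrow> complex) \<Rightarrow> complex^'n \<Rightarrow> complex^'n" where
  "tensor_apply k A x =
     (\<chi> i. \<Sum>idx \<in> multi_indices (k - 1). A (i # idx) * (\<Prod>j<k - 1. x $ (idx ! j)))"

definition hadamard_power :: "nat \<Rightarrow> complex^'n::finite \<Rightarrow> complex^'n" where
  "hadamard_power m x = (\<chi> i. (x $ i) ^ m)"

definition eigenpair :: "nat \<Rightarrow> ('n::finite list \<Rightarrow> complex) \<Rightarrow> complex \<Rightarrow> complex^'n \<Rightarrow> bool" where
  "eigenpair k A lam x \<longleftrightarrow>
     x \<noteq> 0 \<and> tensor_apply k A x = lam *s hadamard_power (k - 1) x"

text \<open>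
  Matrix of the complex partial derivatives; the library's \<open>jacobian\<close> is only for real vectors.
\<close>

definition complex_jacobian :: "(complex^'n::finite \<Rightarrow> complex^'m::finite) \<Rightarrow> complex^'n \<Rightarrow> complex^'n^'m" where
  "complex_jacobian F x =
     (\<chi> i j. deriv (\<lambda>t. F (\<chi> l. if l = j then t else x $ l) $ i) (x $ j))"

definition nondegenerate_eigenvector ::
    "nat \<Rightarrow> ('n::finite list \<Rightarrow> complex) \<Rightarrow> complex \<Rightarrow> complex^'n \<Rightarrow> bool" where
  "nondegenerate_eigenvector k A lam x \<longleftrightarrow>
     rank (complex_jacobian (\<lambda>y. tensor_apply k A y - lam *s hadamard_power (k - 1) y) x)
       = CARD('n) - 1"

end

theory Submission
  imports Defs
begin

text \<open>
  The tensors with a degenerate eigenvector depend on fewer parameters than all tensors do.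
  If \<open>x\<close> is an eigenvector of \<open>A\<close> for \<open>lam\<close>, then by Euler's identity \<open>x\<close> is in the kernel of the
  Jacobian of the system, so degeneracy means that there is a kernel vector \<open>v\<close> independent
  of \<open>x\<close>. After rescaling there are \<open>i \<noteq> j\<close> with \<open>x\<^sub>i = 1\<close>, \<open>v\<^sub>i = 0\<close> and \<open>v\<^sub>j = 1\<close>
  (lemma \<open>degenerate_eigenvector_normal_form\<close>).
  For fixed \<open>(lam, x, v)\<close> the eigenvector and the kernel equations are \<open>2n\<close> linear equations in
  \<open>A\<close>, two for each row. In every row they can be solved for the entries at
  \<open>(i, \<dots>, i)\<close> and \<open>(j, i, \<dots>, i)\<close>, and the solution is polynomial in \<open>lam\<close>, \<open>x\<close>, \<open>v\<close> and the
  other entries. The parameters \<open>lam\<close>, \<open>x\<^sub>l\<close> and \<open>v\<^sub>l\<close> with \<open>l \<noteq> i\<close> number only \<open>2n - 1\<close>, so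
  the degenerate tensors are covered by finitely many polynomial images, one for each \<open>(i, j)\<close>, of
  affine spaces of smaller dimension (lemma \<open>degenerate_tensor_attained\<close>).

  It remains to see that such a union is contained in a hypersurface
  (lemma \<open>generic_if_exceptions_parametrised\<close>). This is elementary: polynomials of large degree
  have more coefficients than there are conditions for their pullbacks to the parameter spaces to
  vanish, so a nonzero one vanishes on all the images.
\<close>

section \<open>Linear algebra\<close>

text \<open>
  This is Gaussian elimination, stated for arbitrary finite index sets: the unknowns will be the
  coefficients of a polynomial in one application and the coordinates of a vector in another.
\<close>

lemma homogeneous_system_nontrivial_solution:
  fixes M :: "'e \<Rightarrow> 'u \<Rightarrow> 'a::field"
  assumes "finite E" "finite U" "card E < card U"
  shows "\<exists>c. (\<exists>u\<in>U. c u \<noteq> 0) \<and> (\<forall>e\<in>E. (\<Sum>u\<in>U. M e u * c u) = 0)"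
  using assms
proof (induction arbitrary: U M rule: finite_induct)
  case empty
  then have "U \<noteq> {}" by auto
  then show ?case by (intro exI[of _ "\<lambda>_. 1"]) auto
next
  case (insert e E)
  show ?case
  proof (cases "\<forall>u\<in>U. M e u = 0")
    case True
    obtain c where "\<exists>u\<in>U. c u \<noteq> 0" "\<forall>f\<in>E. (\<Sum>u\<in>U. M f u * c u) = 0"
      using insert.IH[of U M] insert.prems insert.hyps by auto
    with True show ?thesis by (intro exI[of _ c]) auto
  next
    case False
    then obtain w where w: "w \<in> U" "M e w \<noteq> 0" by auto
    \<comment> \<open>Eliminate the unknown \<open>w\<close> with the pivot equation \<open>e\<close>; \<open>z\<close> below is the value forced on it.\<close>
    define U' where "U' = U - {w}"
    have "finite U'" "card E < card U'"
      using insert.prems insert.hyps w(1) by (auto simp: U'_def card_Diff_singleton)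
    then obtain c where c: "\<exists>u\<in>U'. c u \<noteq> 0"
      and sol: "\<forall>f\<in>E. (\<Sum>u\<in>U'. (M f u - M f w / M e w * M e u) * c u) = 0"
      using insert.IH[of U' "\<lambda>f u. M f u - M f w / M e w * M e u"] by blast
    define z where "z = - (\<Sum>u\<in>U'. M e u * c u) / M e w"
    have split: "(\<Sum>u\<in>U. M f u * (c(w := z)) u) = M f w * z + (\<Sum>u\<in>U'. M f u * c u)" for f
    proof -
      have "(\<Sum>u\<in>U. M f u * (c(w := z)) u)
          = M f w * (c(w := z)) w + (\<Sum>u\<in>U'. M f u * (c(w := z)) u)"
        unfolding U'_def using insert.prems(1) w(1) by (rule sum.remove)
      also have "(\<Sum>u\<in>U'. M f u * (c(w := z)) u) = (\<Sum>u\<in>U'. M f u * c u)"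
        by (rule sum.cong) (auto simp: U'_def)
      finally show ?thesis by simp
    qed
    have "(\<Sum>u\<in>U. M f u * (c(w := z)) u) = 0" if "f \<in> insert e E" for f
    proof (cases "f = e")
      case True
      then show ?thesis unfolding split using w by (simp add: z_def)
    next
      case False
      then have "0 = (\<Sum>u\<in>U'. M f u * c u) - M f w / M e w * (\<Sum>u\<in>U'. M e u * c u)"
        using sol that by (simp add: sum_subtractf sum_distrib_left algebra_simps)
      then show ?thesis unfolding split using w by (simp add: z_def field_simps)
    qed
    moreover have "\<exists>u\<in>U. (c(w := z)) u \<noteq> 0" using c by (auto simp: U'_def)
    ultimately show ?thesis by blast
  qed
qed

text \<open>
  The kernel of a square matrix with \<open>x\<close> in its kernel has dimension at least 2 when the rank
  is not \<open>n - 1\<close>, so it contains a nonzero \<open>v\<close> with \<open>v\<^sub>i = 0\<close>. Subtracting multiples of \<open>x\<close> would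
  move any kernel vector there, but the proof gets \<open>v\<close> at once: since \<open>x\<^sub>i \<noteq> 0\<close>, the \<open>i\<close>th
  unit vector is not in the row space, hence the rank is at most \<open>n - 2\<close>, and the equations
  given by a basis of the row space together with \<open>v\<^sub>i = 0\<close> are fewer than the \<open>n\<close> unknowns.
\<close>

lemma kernel_vector_of_low_rank:
  fixes M :: "'a::field^'n^'n"
  assumes rank: "rank M \<noteq> CARD('n) - 1" and x: "M *v x = 0" "x $ i \<noteq> 0"
  shows "\<exists>v. v \<noteq> 0 \<and> v $ i = 0 \<and> M *v v = 0"
proof -
  obtain B where B: "B \<subseteq> rows M" "vec.independent B" "rows M \<subseteq> vec.span B"
      "card B = rank M"
    using vec.basis_exists[of "rows M"] by (metis row_rank_def_gen)
  have "finite B" using B(2) by (rule vec.finiteI_independent)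
  have annihilates: "w \<in> vec.span S \<Longrightarrow> (\<Sum>l\<in>UNIV. w $ l * u $ l) = 0"
    if "\<And>b. b \<in> S \<Longrightarrow> (\<Sum>l\<in>UNIV. b $ l * u $ l) = 0" for u w :: "'a^'n" and S
  proof -
    have "vec.subspace {w. (\<Sum>l\<in>UNIV. w $ l * u $ l) = 0}"
      by (auto simp: vec.subspace_def distrib_right sum.distrib mult.assoc
          simp flip: sum_distrib_left)
    then show "w \<in> vec.span S \<Longrightarrow> (\<Sum>l\<in>UNIV. w $ l * u $ l) = 0"
      using that vec.span_minimal[of S "{w. (\<Sum>l\<in>UNIV. w $ l * u $ l) = 0}"] by auto
  qed
  have rows_kernel: "M *v u = 0 \<longleftrightarrow> (\<forall>b\<in>rows M. (\<Sum>l\<in>UNIV. b $ l * u $ l) = 0)" for u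
    by (auto simp: rows_def row_def matrix_vector_mult_def vec_eq_iff)
  have "axis i 1 \<notin> vec.span (rows M)"
  proof
    assume "axis i 1 \<in> vec.span (rows M)"
    then have "(\<Sum>l\<in>UNIV. axis i 1 $ l * x $ l) = 0"
      using annihilates x(1) rows_kernel by blast
    then show False
      using x(2) by (simp add: axis_def if_distrib[where f="\<lambda>y. y * _"] cong: if_cong)
  qed
  then have "rank M \<noteq> CARD('n)"
    using vec.dim_eq_full[of "rows M"] by (auto simp: row_rank_def_gen vec_dim_card vec.dimension_def card_cart_basis)
  moreover have "rank M \<le> CARD('n)"
    using vec.dim_subset_UNIV[of "rows M"] by (simp add: row_rank_def_gen vec.dimension_def card_cart_basis)
  ultimately have "card (insert (axis i 1) B) < CARD('n)"
    using rank \<open>finite B\<close> B(4) by (auto simp: card_insert_if)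
  then obtain c :: "'n \<Rightarrow> 'a" where c: "\<exists>l. c l \<noteq> 0"
      and eqs: "\<forall>b\<in>insert (axis i 1) B. (\<Sum>l\<in>UNIV. b $ l * c l) = 0"
    using homogeneous_system_nontrivial_solution[of "insert (axis i 1) B" UNIV "\<lambda>b l. b $ l"]
      \<open>finite B\<close> by auto
  define v :: "'a^'n" where "v = (\<chi> l. c l)"
  have "v \<noteq> 0" using c by (auto simp: v_def vec_eq_iff)
  moreover have "v $ i = 0"
    using eqs by (simp add: v_def axis_def if_distrib[where f="\<lambda>y. y * _"] cong: if_cong)
  moreover have "M *v v = 0"
    unfolding rows_kernel using annihilates[of B v] eqs B(3) by (auto simp: v_def)
  ultimately show ?thesis by blast
qed

section \<open>Functions that are polynomial in each coordinate\<close>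

text \<open>
  Counting dimensions needs only a bound on the degree in each variable separately. Stating it
  for functions, one variable at a time, means that univariate polynomials suffice and that
  no composition of multivariate polynomials has to be formed.
\<close>

definition coordinate_degree_le :: "nat \<Rightarrow> (('v \<Rightarrow> 'a) \<Rightarrow> 'a::comm_semiring_1) \<Rightarrow> bool" where
  "coordinate_degree_le D f \<longleftrightarrow>
     (\<forall>a v. \<exists>p. degree p \<le> D \<and> (\<forall>t. f (a(v := t)) = poly p t))"

lemma coordinate_degree_le_const: "coordinate_degree_le D (\<lambda>_. c)"
  unfolding coordinate_degree_le_def by (auto intro!: exI[of _ "[:c:]"])

lemma coordinate_degree_le_coordinate:
  fixes w :: 'v
  shows "coordinate_degree_le 1 (\<lambda>a :: 'v \<Rightarrow> 'a::comm_semiring_1. a w)"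
  unfolding coordinate_degree_le_def
proof (intro allI)
  fix a :: "'v \<Rightarrow> 'a" and v
  show "\<exists>p. degree p \<le> 1 \<and> (\<forall>t. (a(v := t)) w = poly p t)"
    by (cases "v = w") (auto intro: exI[of _ "[:0, 1:]"] exI[of _ "[:a w:]"])
qed

lemma coordinate_degree_le_mono:
  "coordinate_degree_le D f \<Longrightarrow> D \<le> D' \<Longrightarrow> coordinate_degree_le D' f"
  unfolding coordinate_degree_le_def by (meson order_trans)

lemma coordinate_degree_le_add:
  assumes "coordinate_degree_le D f" "coordinate_degree_le D g"
  shows "coordinate_degree_le D (\<lambda>a. f a + g a)"
  unfolding coordinate_degree_le_def
proof (intro allI)
  fix a v
  obtain p q where "degree p \<le> D" "degree q \<le> D"
    "\<forall>t. f (a(v := t)) = poly p t" "\<forall>t. g (a(v := t)) = poly q t"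
    using assms unfolding coordinate_degree_le_def by meson
  then show "\<exists>p. degree p \<le> D \<and> (\<forall>t. f (a(v := t)) + g (a(v := t)) = poly p t)"
    by (intro exI[of _ "p + q"]) (auto intro: degree_add_le)
qed

lemma coordinate_degree_le_mult:
  assumes "coordinate_degree_le D f" "coordinate_degree_le D' g"
  shows "coordinate_degree_le (D + D') (\<lambda>a. f a * g a)"
  unfolding coordinate_degree_le_def
proof (intro allI)
  fix a v
  obtain p q where "degree p \<le> D" "degree q \<le> D'"
    "\<forall>t. f (a(v := t)) = poly p t" "\<forall>t. g (a(v := t)) = poly q t"
    using assms unfolding coordinate_degree_le_def by meson
  then show "\<exists>p. degree p \<le> D + D' \<and> (\<forall>t. f (a(v := t)) * g (a(v := t)) = poly p t)"
    by (intro exI[of _ "p * q"]) (auto intro: order_trans[OF degree_mult_le])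
qed

lemma coordinate_degree_le_sum:
  "(\<And>s. s \<in> S \<Longrightarrow> coordinate_degree_le D (f s)) \<Longrightarrow> coordinate_degree_le D (\<lambda>a. \<Sum>s\<in>S. f s a)"
  by (induction S rule: infinite_finite_induct)
    (auto intro: coordinate_degree_le_const coordinate_degree_le_add)

lemma coordinate_degree_le_prod:
  "(\<And>s. s \<in> S \<Longrightarrow> coordinate_degree_le D (f s)) \<Longrightarrow>
    coordinate_degree_le (card S * D) (\<lambda>a. \<Prod>s\<in>S. f s a)"
  by (induction S rule: infinite_finite_induct)
    (auto intro: coordinate_degree_le_const coordinate_degree_le_mult)

lemma coordinate_degree_le_power:
  "coordinate_degree_le D f \<Longrightarrow> coordinate_degree_le (n * D) (\<lambda>a. f a ^ n)"
  by (induction n) (auto intro: coordinate_degree_le_const coordinate_degree_le_mult)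

definition coordinatewise_polynomial :: "(('v \<Rightarrow> 'a) \<Rightarrow> 'a::comm_semiring_1) \<Rightarrow> bool" where
  "coordinatewise_polynomial f \<longleftrightarrow> (\<exists>D. coordinate_degree_le D f)"

lemma coordinatewise_polynomial_const: "coordinatewise_polynomial (\<lambda>_. c)"
  unfolding coordinatewise_polynomial_def by (blast intro: coordinate_degree_le_const)

lemma coordinatewise_polynomial_coordinate: "coordinatewise_polynomial (\<lambda>a. a w)"
  unfolding coordinatewise_polynomial_def by (blast intro: coordinate_degree_le_coordinate)

lemma coordinatewise_polynomial_mult:
  "coordinatewise_polynomial f \<Longrightarrow> coordinatewise_polynomial g \<Longrightarrow>
    coordinatewise_polynomial (\<lambda>a. f a * g a)"
  unfolding coordinatewise_polynomial_def by (blast intro: coordinate_degree_le_mult)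

lemma coordinatewise_polynomial_add:
  assumes "coordinatewise_polynomial f" "coordinatewise_polynomial g"
  shows "coordinatewise_polynomial (\<lambda>a. f a + g a)"
proof -
  obtain D D' where "coordinate_degree_le D f" "coordinate_degree_le D' g"
    using assms unfolding coordinatewise_polynomial_def by blast
  then have "coordinate_degree_le (max D D') (\<lambda>a. f a + g a)"
    by (intro coordinate_degree_le_add) (auto elim: coordinate_degree_le_mono)
  then show ?thesis unfolding coordinatewise_polynomial_def by blast
qed

lemma coordinatewise_polynomial_diff:
  fixes f g :: "('v \<Rightarrow> 'a) \<Rightarrow> 'a::comm_ring_1"
  assumes "coordinatewise_polynomial f" "coordinatewise_polynomial g"
  shows "coordinatewise_polynomial (\<lambda>a. f a - g a)"
  using coordinatewise_polynomial_add[OF assms(1)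
      coordinatewise_polynomial_mult[OF coordinatewise_polynomial_const[of "-1"] assms(2)]]
  by simp

lemma coordinatewise_polynomial_sum:
  "(\<And>s. s \<in> S \<Longrightarrow> coordinatewise_polynomial (f s)) \<Longrightarrow>
    coordinatewise_polynomial (\<lambda>a. \<Sum>s\<in>S. f s a)"
  by (induction S rule: infinite_finite_induct)
    (auto intro: coordinatewise_polynomial_const coordinatewise_polynomial_add)

lemma coordinatewise_polynomial_prod:
  "(\<And>s. s \<in> S \<Longrightarrow> coordinatewise_polynomial (f s)) \<Longrightarrow>
    coordinatewise_polynomial (\<lambda>a. \<Prod>s\<in>S. f s a)"
  by (induction S rule: infinite_finite_induct)
    (auto intro: coordinatewise_polynomial_const coordinatewise_polynomial_mult)

lemma coordinatewise_polynomial_power: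
  "coordinatewise_polynomial f \<Longrightarrow> coordinatewise_polynomial (\<lambda>a. f a ^ n)"
  unfolding coordinatewise_polynomial_def by (blast intro: coordinate_degree_le_power)

lemma coordinatewise_polynomial_if:
  "coordinatewise_polynomial f \<Longrightarrow> coordinatewise_polynomial g \<Longrightarrow>
    coordinatewise_polynomial (\<lambda>a. if Q then f a else g a)"
  by (cases Q) auto

lemmas coordinatewise_polynomial_intros =
  coordinatewise_polynomial_const coordinatewise_polynomial_coordinate
  coordinatewise_polynomial_add coordinatewise_polynomial_diff coordinatewise_polynomial_mult
  coordinatewise_polynomial_sum coordinatewise_polynomial_prod coordinatewise_polynomial_power
  coordinatewise_polynomial_if

text \<open>
  A nonzero univariate polynomial of degree at most \<open>D\<close> cannot vanish on more than \<open>D\<close> points.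
  Freeing the coordinates from the grid one after the other extends this to several variables.
  The number of points of the grid is what bounds the number of conditions for a pullback to vanish.
\<close>

lemma coordinate_degree_le_vanishing_on_grid:
  fixes f :: "('v \<Rightarrow> 'a::idom) \<Rightarrow> 'a"
  assumes f: "coordinate_degree_le D f" and "finite J" and S: "D < card S"
    and grid: "\<And>g. g \<in> J \<rightarrow>\<^sub>E S \<Longrightarrow> f g = 0"
    and b: "b \<in> affine_space J"
  shows "f b = 0"
proof -
  have "finite S" using S card.infinite by fastforce
  \<comment> \<open>\<open>H\<close> is the set of coordinates that have already been freed from the grid.\<close>
  have "f a = 0" if "H \<subseteq> J" "a \<in> affine_space J" "\<And>v. v \<in> J - H \<Longrightarrow> a v \<in> S" for H a
    using finite_subset[OF that(1) \<open>finite J\<close>] that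
  proof (induction H arbitrary: a rule: finite_induct)
    case empty
    then show ?case by (intro grid) (auto simp: affine_space_def PiE_iff)
  next
    case (insert w H)
    obtain p where p: "degree p \<le> D" "\<And>t. f (a(w := t)) = poly p t"
      using f unfolding coordinate_degree_le_def by meson
    have "poly p t = 0" if "t \<in> S" for t
    proof -
      have "f (a(w := t)) = 0"
        using insert.prems that insert.hyps by (intro insert.IH) (auto simp: affine_space_def PiE_iff extensional_def)
      then show ?thesis using p by simp
    qed
    then have "S \<subseteq> {t. poly p t = 0}" by auto
    have "p = 0"
    proof (rule ccontr)
      assume "p \<noteq> 0"
      then have "card S \<le> degree p"
        using card_mono[OF poly_roots_finite[OF \<open>p \<noteq> 0\<close>] \<open>S \<subseteq> _\<close>] card_poly_roots_bound[OF \<open>p \<noteq> 0\<close>] by linarith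
      then show False using p S by linarith
    qed
    then show ?case using p(2)[of "a w"] by simp
  qed
  from this[of J b] b show ?thesis by auto
qed

section \<open>Sets with few parameters are not Zariski dense\<close>

text \<open>
  Collecting the terms by their power of one variable reduces the claim to one variable less:
  some coefficient is nonzero by induction, and a nonzero univariate polynomial has a nonroot.
\<close>

lemma monomials_linearly_independent:
  fixes c :: "('v \<Rightarrow> nat) \<Rightarrow> 'a::{idom,ring_char_0}"
  assumes "finite I" "m \<in> I \<rightarrow>\<^sub>E {..<d}" "c m \<noteq> 0"
  shows "\<exists>a\<in>affine_space I. (\<Sum>m\<in>I \<rightarrow>\<^sub>E {..<d}. c m * (\<Prod>v\<in>I. a v ^ m v)) \<noteq> 0"
  using assms
proof (induction I arbitrary: c m rule: finite_induct)
  case empty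
  then show ?case by (auto simp: affine_space_def)
next
  case (insert w I)
  define m' where "m' = m(w := undefined)"
  have m': "m' \<in> I \<rightarrow>\<^sub>E {..<d}" "m = m'(w := m w)" "m w < d"
    using insert by (auto simp: m'_def PiE_iff extensional_def fun_eq_iff)
  obtain a where a: "a \<in> affine_space I"
      "(\<Sum>l\<in>I \<rightarrow>\<^sub>E {..<d}. c (l(w := m w)) * (\<Prod>v\<in>I. a v ^ l v)) \<noteq> 0"
    using insert.IH[of m' "\<lambda>l. c (l(w := m w))"] m' insert.prems by auto
  define q where "q = (\<Sum>e<d. monom (\<Sum>l\<in>I \<rightarrow>\<^sub>E {..<d}. c (l(w := e)) * (\<Prod>v\<in>I. a v ^ l v)) e)"
  have "coeff q (m w) \<noteq> 0"
    using a m' by (simp add: q_def coeff_sum coeff_monom if_distrib cong: if_cong)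
  then have "q \<noteq> 0" by auto
  then obtain t where t: "poly q t \<noteq> 0"
    using poly_all_0_iff_0 by blast
  have bij: "bij_betw (\<lambda>(e, l). l(w := e)) ({..<d} \<times> (I \<rightarrow>\<^sub>E {..<d})) (insert w I \<rightarrow>\<^sub>E {..<d})"
    unfolding bij_betw_def using inj_combinator[OF insert.hyps(2), of "\<lambda>_. {..<d}"]
    by (auto simp: PiE_insert_eq)
  have "(\<Sum>m\<in>insert w I \<rightarrow>\<^sub>E {..<d}. c m * (\<Prod>v\<in>insert w I. (a(w := t)) v ^ m v))
      = (\<Sum>(e, l)\<in>{..<d} \<times> (I \<rightarrow>\<^sub>E {..<d}).
           c (l(w := e)) * (\<Prod>v\<in>insert w I. (a(w := t)) v ^ (l(w := e)) v))"
    by (subst sum.reindex_bij_betw[OF bij, symmetric]) (simp add: case_prod_beta)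
  also have "\<dots> = (\<Sum>(e, l)\<in>{..<d} \<times> (I \<rightarrow>\<^sub>E {..<d}).
           c (l(w := e)) * (\<Prod>v\<in>I. a v ^ l v) * t ^ e)"
  proof (intro sum.cong refl, clarify)
    fix e l
    have "(\<Prod>v\<in>I. (a(w := t)) v ^ (l(w := e)) v) = (\<Prod>v\<in>I. a v ^ l v)"
      using insert.hyps by (intro prod.cong) auto
    then show "c (l(w := e)) * (\<Prod>v\<in>insert w I. (a(w := t)) v ^ (l(w := e)) v)
        = c (l(w := e)) * (\<Prod>v\<in>I. a v ^ l v) * t ^ e"
      using insert.hyps by (simp add: mult_ac)
  qed
  also have "\<dots> = poly q t"
    by (simp add: q_def poly_sum poly_monom sum_distrib_right sum.cartesian_product)
  finally show ?case
    using t a(1) by (intro bexI[of _ "a(w := t)"]) (auto simp: affine_space_def PiE_iff extensional_def)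
qed

text \<open>
  The translation between finitely supported maps, which define Zariski closed sets, and explicit
  sums over a box of exponents, in which the number of coefficients is evident.
\<close>

lemma mpoly_with_coefficients:
  fixes c :: "('v \<Rightarrow> nat) \<Rightarrow> 'a::comm_semiring_1"
  assumes "finite I"
  shows "\<exists>p. mpoly_vars p \<subseteq> I \<and>
    (\<forall>a. mpoly_eval p a = (\<Sum>m\<in>I \<rightarrow>\<^sub>E {..<d}. c m * (\<Prod>v\<in>I. a v ^ m v)))"
proof -
  define U where "U = I \<rightarrow>\<^sub>E {..<d}"
  have "finite U" using assms by (simp add: U_def finite_PiE)
  define \<mu> where "\<mu> m = Abs_poly_mapping (\<lambda>v. if v \<in> I then m v else 0)" for m :: "'v \<Rightarrow> nat"
  have lookup_\<mu>: "Poly_Mapping.lookup (\<mu> m) v = (if v \<in> I then m v else 0)" for m v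
    unfolding \<mu>_def using assms by (subst lookup_Abs_poly_mapping) auto
  then have keys_\<mu>: "Poly_Mapping.keys (\<mu> m) \<subseteq> I" for m
    by (auto simp: in_keys_iff split: if_splits)
  have inj: "inj_on \<mu> U"
  proof
    fix m m' assume "m \<in> U" "m' \<in> U" "\<mu> m = \<mu> m'"
    moreover have "m v = m' v" if "v \<in> I" for v
      using that \<open>\<mu> m = \<mu> m'\<close> lookup_\<mu>[of m v] lookup_\<mu>[of m' v] by simp
    ultimately show "m = m'" unfolding U_def by (meson PiE_ext)
  qed
  define p where "p = (\<Sum>m\<in>U. Poly_Mapping.single (\<mu> m) (c m))"
  have lookup_p: "Poly_Mapping.lookup p (\<mu> m) = c m" if "m \<in> U" for m
  proof -
    have "Poly_Mapping.lookup p (\<mu> m) = (\<Sum>m'\<in>U. if m' = m then c m' else 0)"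
      unfolding p_def lookup_sum lookup_single
      using that inj by (intro sum.cong) (auto simp: when_def inj_on_eq_iff)
    also have "\<dots> = c m" using that \<open>finite U\<close> by simp
    finally show ?thesis .
  qed
  have keys_p: "Poly_Mapping.keys p \<subseteq> \<mu> ` U"
    unfolding p_def by (rule order_trans[OF keys_sum]) auto
  have "mpoly_eval p a = (\<Sum>m\<in>U. c m * (\<Prod>v\<in>I. a v ^ m v))" for a
  proof -
    have "mpoly_eval p a = (\<Sum>k\<in>\<mu> ` U. Poly_Mapping.lookup p k *
        (\<Prod>v\<in>Poly_Mapping.keys k. a v ^ Poly_Mapping.lookup k v))"
      unfolding mpoly_eval_def using keys_p \<open>finite U\<close>
      by (intro sum.mono_neutral_left) (auto simp: in_keys_iff)
    also have "\<dots> = (\<Sum>m\<in>U. c m * (\<Prod>v\<in>Poly_Mapping.keys (\<mu> m). a v ^ Poly_Mapping.lookup (\<mu> m) v))"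
      using inj by (simp add: sum.reindex lookup_p)
    also have "\<dots> = (\<Sum>m\<in>U. c m * (\<Prod>v\<in>I. a v ^ m v))"
    proof (intro sum.cong refl arg_cong2[where f = "(*)"])
      fix m
      have "(\<Prod>v\<in>Poly_Mapping.keys (\<mu> m). a v ^ Poly_Mapping.lookup (\<mu> m) v)
          = (\<Prod>v\<in>I. a v ^ Poly_Mapping.lookup (\<mu> m) v)"
        using keys_\<mu> assms by (intro prod.mono_neutral_left) (auto simp: in_keys_iff)
      also have "\<dots> = (\<Prod>v\<in>I. a v ^ m v)" by (simp add: lookup_\<mu>)
      finally show "(\<Prod>v\<in>Poly_Mapping.keys (\<mu> m). a v ^ Poly_Mapping.lookup (\<mu> m) v)
          = (\<Prod>v\<in>I. a v ^ m v)" .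
    qed
    finally show ?thesis .
  qed
  moreover have "mpoly_vars p \<subseteq> I"
    using keys_p keys_\<mu> by (fastforce simp: mpoly_vars_def)
  ultimately show ?thesis unfolding U_def by blast
qed

text \<open>
  The image of an affine space under a polynomial map into an affine space of larger dimension lies
  in a hypersurface, and one hypersurface serves for finitely many such maps. With \<open>N\<close>
  the dimension of the target and \<open>e\<close> a bound for the degrees of the maps, a polynomial of degree
  less than \<open>d\<close> in each variable has \<open>d ^ N\<close> coefficients, and its pullbacks have degree at
  most \<open>N * d * e\<close> in each of at most \<open>N - 1\<close> parameters. They vanish as soon as they vanish on grids
  with \<open>N * d * e + 1\<close> values per parameter. So there are \<open>O(d ^ (N - 1))\<close> linear conditions on
  \<open>d ^ N\<close> coefficients, and a nonzero solution exists for large \<open>d\<close>.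
\<close>

lemma generic_if_exceptions_parametrised:
  fixes \<Phi> :: "'k \<Rightarrow> ('w \<Rightarrow> 'a::field_char_0) \<Rightarrow> 'v \<Rightarrow> 'a"
  assumes fin: "finite K" "finite I" "\<And>\<kappa>. \<kappa> \<in> K \<Longrightarrow> finite (J \<kappa>)"
    and dim: "\<And>\<kappa>. \<kappa> \<in> K \<Longrightarrow> card (J \<kappa>) < card I"
    and poly: "\<And>\<kappa> v. \<kappa> \<in> K \<Longrightarrow> v \<in> I \<Longrightarrow> coordinatewise_polynomial (\<lambda>b. \<Phi> \<kappa> b v)"
    and cover: "\<And>a. a \<in> affine_space I \<Longrightarrow> \<not> P a \<Longrightarrow>
      \<exists>\<kappa>\<in>K. \<exists>b\<in>affine_space (J \<kappa>). \<forall>v\<in>I. a v = \<Phi> \<kappa> b v"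
  shows "generic I P"
proof -
  obtain D where D: "\<And>\<kappa> v. \<kappa> \<in> K \<Longrightarrow> v \<in> I \<Longrightarrow> coordinate_degree_le (D \<kappa> v) (\<lambda>b. \<Phi> \<kappa> b v)"
    using poly unfolding coordinatewise_polynomial_def by metis
  define e where "e = (\<Sum>(\<kappa>, v)\<in>K \<times> I. D \<kappa> v)"
  have e: "coordinate_degree_le e (\<lambda>b. \<Phi> \<kappa> b v)" if "\<kappa> \<in> K" "v \<in> I" for \<kappa> v
  proof (rule coordinate_degree_le_mono[OF D[OF that]])
    show "D \<kappa> v \<le> e"
      unfolding e_def using that fin member_le_sum[of "(\<kappa>, v)" "K \<times> I" "\<lambda>(\<kappa>, v). D \<kappa> v"] by simp
  qed
  define N where "N = card I"
  \<comment> \<open>This makes \<open>card K * (d * (N * e + 1)) ^ (N - 1)\<close>, which bounds the number of conditions,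
    smaller than \<open>d ^ N\<close>.\<close>
  define d where "d = card K * (N * e + 1) ^ (N - 1) + 1"
  define G where "G = (of_nat :: nat \<Rightarrow> 'a) ` {..N * (d * e)}"
  have "finite G" and card_G: "card G = N * (d * e) + 1"
    by (auto simp: G_def card_image)
  define E where "E = (SIGMA \<kappa>:K. J \<kappa> \<rightarrow>\<^sub>E G)"
  define U where "U = I \<rightarrow>\<^sub>E {..<d}"
  have finE: "finite E" and finU: "finite U"
    using fin \<open>finite G\<close> by (auto simp: E_def U_def intro!: finite_PiE)
  have "card E < card U"
  proof (cases "K = {}")
    case True
    then show ?thesis using fin by (simp add: E_def U_def card_PiE d_def)
  next
    case False
    then have "N > 0" using dim by (fastforce simp: N_def)
    have "card G \<le> d * (N * e + 1)" by (simp add: card_G d_def algebra_simps)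
    have "card E = (\<Sum>\<kappa>\<in>K. card G ^ card (J \<kappa>))"
      using fin \<open>finite G\<close> by (simp add: E_def card_SigmaI finite_PiE card_PiE)
    also have "\<dots> \<le> (\<Sum>\<kappa>\<in>K. card G ^ (N - 1))"
      using dim by (intro sum_mono power_increasing) (fastforce simp: N_def card_G)+
    also have "\<dots> \<le> card K * (d * (N * e + 1)) ^ (N - 1)"
      using \<open>card G \<le> _\<close> by (simp add: power_mono)
    also have "\<dots> = card K * (N * e + 1) ^ (N - 1) * d ^ (N - 1)"
      by (simp only: power_mult_distrib mult_ac)
    also have "card K * (N * e + 1) ^ (N - 1) = d - 1" by (simp add: d_def)
    also have "(d - 1) * d ^ (N - 1) < d * d ^ (N - 1)" by (simp add: d_def)
    also have "\<dots> = card U"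
      using fin \<open>N > 0\<close> by (simp add: U_def card_PiE N_def flip: power_Suc)
    finally show ?thesis .
  qed
  then obtain c where c: "\<exists>m\<in>U. c m \<noteq> 0" and
    sol: "\<And>\<kappa> g. (\<kappa>, g) \<in> E \<Longrightarrow> (\<Sum>m\<in>U. (\<Prod>v\<in>I. \<Phi> \<kappa> g v ^ m v) * c m) = 0"
    using homogeneous_system_nontrivial_solution[OF finE finU,
        of "\<lambda>(\<kappa>, g) m. \<Prod>v\<in>I. \<Phi> \<kappa> g v ^ m v"] by fastforce
  obtain p where vars: "mpoly_vars p \<subseteq> I"
    and eval: "\<And>a. mpoly_eval p a = (\<Sum>m\<in>U. c m * (\<Prod>v\<in>I. a v ^ m v))"
    using mpoly_with_coefficients[OF fin(2), where d = d and c = c] unfolding U_def by blast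
  have pullback_zero: "mpoly_eval p (\<Phi> \<kappa> b) = 0" if "\<kappa> \<in> K" "b \<in> affine_space (J \<kappa>)" for \<kappa> b
  proof (rule coordinate_degree_le_vanishing_on_grid[where S = G and J = "J \<kappa>"
        and f = "\<lambda>b. mpoly_eval p (\<Phi> \<kappa> b)"])
    show "coordinate_degree_le (N * (d * e)) (\<lambda>b. mpoly_eval p (\<Phi> \<kappa> b))"
      unfolding eval
    proof (rule coordinate_degree_le_sum)
      fix m assume "m \<in> U"
      have "coordinate_degree_le (d * e) (\<lambda>b. \<Phi> \<kappa> b v ^ m v)" if "v \<in> I" for v
        using \<open>m \<in> U\<close> that
        by (intro coordinate_degree_le_mono[OF coordinate_degree_le_power[OF e[OF \<open>\<kappa> \<in> K\<close> that]]])
          (auto simp: U_def PiE_iff less_imp_le)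
      from coordinate_degree_le_mult[OF coordinate_degree_le_const[of 0 "c m"]
          coordinate_degree_le_prod[of I "d * e", OF this]]
      show "coordinate_degree_le (N * (d * e)) (\<lambda>b. c m * (\<Prod>v\<in>I. \<Phi> \<kappa> b v ^ m v))"
        by (simp add: N_def)
    qed
    show "mpoly_eval p (\<Phi> \<kappa> g) = 0" if "g \<in> J \<kappa> \<rightarrow>\<^sub>E G" for g
      using sol[of \<kappa> g] that \<open>\<kappa> \<in> K\<close> by (simp add: eval E_def mult.commute)
  qed (use that fin card_G in auto)
  define X where "X = {a \<in> affine_space I. mpoly_eval p a = 0}"
  have "zariski_closed I X"
    unfolding zariski_closed_def X_def using vars by (intro exI[of _ "{p}"]) auto
  moreover have "X \<subset> affine_space I"
    using c monomials_linearly_independent[OF fin(2), where d = d and c = c] unfolding X_def eval U_def by blast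
  moreover have "P a" if a: "a \<in> affine_space I - X" for a
  proof (rule ccontr)
    assume "\<not> P a"
    then obtain \<kappa> b where b: "\<kappa> \<in> K" "b \<in> affine_space (J \<kappa>)" "\<forall>v\<in>I. a v = \<Phi> \<kappa> b v"
      using cover a by blast
    then have "mpoly_eval p a = mpoly_eval p (\<Phi> \<kappa> b)"
      unfolding eval by (intro sum.cong refl arg_cong2[where f = "(*)"] prod.cong) auto
    with pullback_zero b a show False by (simp add: X_def)
  qed
  ultimately show ?thesis unfolding generic_def by blast
qed


section \<open>Eigenvectors with a degenerate Jacobian\<close>

text \<open>
  The monomial that multiplies the entry \<open>A (r # idx)\<close> in the system, with \<open>m = k - 1\<close>.
\<close>

definition index_monomial :: "nat \<Rightarrow> ('n \<Rightarrow> 'a::comm_semiring_1) \<Rightarrow> 'n list \<Rightarrow> 'a" where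
  "index_monomial m x idx = (\<Prod>p<m. x (idx ! p))"

text \<open>
  The derivative of \<open>index_monomial m\<close> at \<open>x\<close> in the direction \<open>v\<close>.
\<close>

definition index_derivative ::
    "nat \<Rightarrow> ('n \<Rightarrow> 'a::comm_semiring_1) \<Rightarrow> ('n \<Rightarrow> 'a) \<Rightarrow> 'n list \<Rightarrow> 'a" where
  "index_derivative m x v idx = (\<Sum>p<m. v (idx ! p) * (\<Prod>q\<in>{..<m} - {p}. x (idx ! q)))"

lemma index_monomial_scale:
  "index_monomial m (\<lambda>l. c * x l) idx = c ^ m * index_monomial m x idx"
  by (simp add: index_monomial_def prod.distrib)

lemma index_derivative_scale:
  "index_derivative m (\<lambda>l. c * x l) (\<lambda>l. s * v l) idx = c ^ (m - 1) * s * index_derivative m x v idx"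
  unfolding index_derivative_def sum_distrib_left
  by (intro sum.cong) (auto simp: prod.distrib mult_ac)

text \<open>
  Euler's identity for homogeneous functions; it places an eigenvector in the kernel of its Jacobian.
\<close>

lemma index_derivative_Euler:
  "index_derivative m x x idx = of_nat m * index_monomial m x idx"
proof -
  have "x (idx ! p) * (\<Prod>q\<in>{..<m} - {p}. x (idx ! q)) = (\<Prod>q<m. x (idx ! q))" if "p < m" for p
    using that by (intro prod.remove[symmetric]) auto
  then show ?thesis by (simp add: index_derivative_def index_monomial_def)
qed

lemma complex_jacobian_eigensystem:
  fixes A :: "'n::finite list \<Rightarrow> complex" and x v :: "complex^'n" and k :: nat
  defines "m \<equiv> k - 1"
  shows "(complex_jacobian (\<lambda>y. tensor_apply k A y - lam *s hadamard_power m y) x *v v) $ r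
    = (\<Sum>idx\<in>multi_indices m. A (r # idx) * index_derivative m (($) x) (($) v) idx)
      - lam * (of_nat m * x $ r ^ (m - 1) * v $ r)"
proof -
  have deriv_monomial: "((\<lambda>t. \<Prod>p<m. if idx ! p = j then t else x $ (idx ! p)) has_field_derivative
      (\<Sum>p<m. (if idx ! p = j then 1 else 0) * (\<Prod>q\<in>{..<m} - {p}. x $ (idx ! q)))) (at (x $ j))"
    for idx j
  proof -
    have "((\<lambda>t. \<Prod>p<m. if idx ! p = j then t else x $ (idx ! p)) has_field_derivative
      (\<Sum>p<m. (if idx ! p = j then 1 else 0) *
        (\<Prod>q\<in>{..<m} - {p}. if idx ! q = j then x $ j else x $ (idx ! q)))) (at (x $ j))"
      by (rule has_field_derivative_prod) (auto intro!: derivative_eq_intros)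
    moreover have "(if idx ! q = j then x $ j else x $ (idx ! q)) = x $ (idx ! q)" for q by auto
    ultimately show ?thesis by simp
  qed
  have entry: "complex_jacobian (\<lambda>y. tensor_apply k A y - lam *s hadamard_power m y) x $ r $ j
    = (\<Sum>idx\<in>multi_indices m. A (r # idx) *
        (\<Sum>p<m. (if idx ! p = j then 1 else 0) * (\<Prod>q\<in>{..<m} - {p}. x $ (idx ! q))))
      - lam * (if r = j then of_nat m * x $ r ^ (m - 1) else 0)" for j
  proof -
    have power: "((\<lambda>t. (if r = j then t else x $ r) ^ m) has_field_derivative
        (if r = j then of_nat m * x $ r ^ (m - 1) else 0)) (at (x $ j))"
      by (cases "r = j") (auto intro!: derivative_eq_intros)
    show ?thesis
      unfolding complex_jacobian_def tensor_apply_def hadamard_power_def m_def[symmetric]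
        vec_lambda_beta vector_minus_component vector_smult_component
      by (intro DERIV_imp_deriv DERIV_diff DERIV_sum DERIV_cmult deriv_monomial power)
  qed
  have "(\<Sum>j\<in>UNIV. (\<Sum>p<m. (if idx ! p = j then 1 else 0) * (\<Prod>q\<in>{..<m} - {p}. x $ (idx ! q))) * v $ j)
      = index_derivative m (($) x) (($) v) idx" for idx
  proof -
    have "(\<Sum>j\<in>UNIV. (\<Sum>p<m. (if idx ! p = j then 1 else 0) * (\<Prod>q\<in>{..<m} - {p}. x $ (idx ! q))) * v $ j)
       = (\<Sum>p<m. \<Sum>j\<in>UNIV. if idx ! p = j then v $ j * (\<Prod>q\<in>{..<m} - {p}. x $ (idx ! q)) else 0)"
      unfolding sum_distrib_right by (subst sum.swap) (auto intro!: sum.cong)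
    then show ?thesis by (simp add: index_derivative_def)
  qed
  note row = this
  have "(complex_jacobian (\<lambda>y. tensor_apply k A y - lam *s hadamard_power m y) x *v v) $ r
    = (\<Sum>j\<in>UNIV. (\<Sum>idx\<in>multi_indices m. A (r # idx) *
        ((\<Sum>p<m. (if idx ! p = j then 1 else 0) * (\<Prod>q\<in>{..<m} - {p}. x $ (idx ! q))) * v $ j))
      - (if r = j then lam * (of_nat m * x $ r ^ (m - 1) * v $ r) else 0))"
    unfolding matrix_vector_mult_def vec_lambda_beta entry left_diff_distrib
    by (intro sum.cong refl arg_cong2[where f = "(-)"])
       (simp_all only: sum_distrib_right mult.assoc, auto)
  also have "\<dots> = (\<Sum>idx\<in>multi_indices m. A (r # idx) * index_derivative m (($) x) (($) v) idx)
      - lam * (of_nat m * x $ r ^ (m - 1) * v $ r)"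
    unfolding sum_subtractf by (subst sum.swap) (simp add: row flip: sum_distrib_left)
  finally show ?thesis .
qed

text \<open>
  The first equation says that \<open>x\<close> is an eigenvector for \<open>lam\<close>, the second that \<open>v\<close> is in the
  kernel of the Jacobian at \<open>x\<close>. For given \<open>lam\<close>, \<open>x\<close>, \<open>v\<close> they are linear in \<open>A\<close>, and each
  row \<open>A (r # _)\<close> of the tensor has its own two equations with the same left-hand functionals.
\<close>

definition degeneracy_equations ::
  "nat \<Rightarrow> ('n::finite list \<Rightarrow> complex) \<Rightarrow> complex \<Rightarrow> ('n \<Rightarrow> complex) \<Rightarrow> ('n \<Rightarrow> complex) \<Rightarrow> bool" where
  "degeneracy_equations m A lam x v \<longleftrightarrow> (\<forall>r.
     (\<Sum>idx\<in>multi_indices m. A (r # idx) * index_monomial m x idx) = lam * x r ^ m \<and>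
     (\<Sum>idx\<in>multi_indices m. A (r # idx) * index_derivative m x v idx)
       = lam * (of_nat m * x r ^ (m - 1) * v r))"

text \<open>
  The system is homogeneous in \<open>x\<close> and linear in \<open>v\<close>, so \<open>x\<close> and \<open>v\<close> can be rescaled
  independently while \<open>lam\<close> stays the same.
\<close>

lemma degenerate_eigenvector_normal_form:
  fixes A :: "'n::finite list \<Rightarrow> complex"
  assumes k: "k \<ge> 2" and eigen: "eigenpair k A lam x"
    and degenerate: "\<not> nondegenerate_eigenvector k A lam x"
  shows "\<exists>i j y v. i \<noteq> j \<and> y i = 1 \<and> v i = 0 \<and> v j = 1 \<and> degeneracy_equations (k - 1) A lam y v"
proof -
  define m where "m = k - 1"
  have "m > 0" using k by (simp add: m_def)
  define M where "M = complex_jacobian (\<lambda>y. tensor_apply k A y - lam *s hadamard_power m y) x"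
  have Mv: "(M *v v) $ r = (\<Sum>idx\<in>multi_indices m. A (r # idx) * index_derivative m (($) x) (($) v) idx)
      - lam * (of_nat m * x $ r ^ (m - 1) * v $ r)" for v r
    unfolding M_def m_def by (rule complex_jacobian_eigensystem)
  have eq: "(\<Sum>idx\<in>multi_indices m. A (r # idx) * index_monomial m (($) x) idx) = lam * x $ r ^ m" for r
    using eigen by (simp add: eigenpair_def tensor_apply_def hadamard_power_def vec_eq_iff
        index_monomial_def m_def)
  obtain i where i: "x $ i \<noteq> 0" using eigen by (auto simp: eigenpair_def vec_eq_iff)
  have "(M *v x) $ r = 0" for r
  proof -
    have "(\<Sum>idx\<in>multi_indices m. A (r # idx) * index_derivative m (($) x) (($) x) idx)
        = of_nat m * (lam * x $ r ^ m)"
      unfolding index_derivative_Euler eq[symmetric] sum_distrib_left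
      by (intro sum.cong) (auto simp: mult_ac)
    then show ?thesis
      using \<open>m > 0\<close> by (simp add: Mv power_eq_if mult_ac)
  qed
  then have "M *v x = 0" by (simp add: vec_eq_iff)
  moreover have "rank M \<noteq> CARD('n) - 1"
    using degenerate by (simp add: nondegenerate_eigenvector_def M_def m_def)
  ultimately obtain v where v: "v \<noteq> 0" "v $ i = 0" "M *v v = 0"
    using kernel_vector_of_low_rank i by blast
  then obtain j where j: "v $ j \<noteq> 0" by (auto simp: vec_eq_iff)
  define c s where "c = inverse (x $ i)" and "s = inverse (v $ j)"
  have "degeneracy_equations m A lam (\<lambda>l. c * x $ l) (\<lambda>l. s * v $ l)"
    unfolding degeneracy_equations_def
  proof (intro allI conjI)
    fix r
    have "(\<Sum>idx\<in>multi_indices m. A (r # idx) * index_monomial m (\<lambda>l. c * x $ l) idx)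
        = c ^ m * (\<Sum>idx\<in>multi_indices m. A (r # idx) * index_monomial m (($) x) idx)"
      unfolding index_monomial_scale sum_distrib_left by (intro sum.cong) (auto simp: mult_ac)
    then show "(\<Sum>idx\<in>multi_indices m. A (r # idx) * index_monomial m (\<lambda>l. c * x $ l) idx)
        = lam * (c * x $ r) ^ m"
      unfolding eq by (simp add: power_mult_distrib mult_ac)
    have "(\<Sum>idx\<in>multi_indices m. A (r # idx) * index_derivative m (($) x) (($) v) idx)
        = lam * (of_nat m * x $ r ^ (m - 1) * v $ r)"
      using Mv[of v r] v(3) by simp
    moreover have "(\<Sum>idx\<in>multi_indices m. A (r # idx) *
          index_derivative m (\<lambda>l. c * x $ l) (\<lambda>l. s * v $ l) idx)
        = c ^ (m - 1) * s * (\<Sum>idx\<in>multi_indices m. A (r # idx) * index_derivative m (($) x) (($) v) idx)"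
      unfolding index_derivative_scale sum_distrib_left by (intro sum.cong) (auto simp: mult_ac)
    ultimately show "(\<Sum>idx\<in>multi_indices m. A (r # idx) *
          index_derivative m (\<lambda>l. c * x $ l) (\<lambda>l. s * v $ l) idx)
        = lam * (of_nat m * (c * x $ r) ^ (m - 1) * (s * v $ r))"
      by (simp add: power_mult_distrib mult_ac)
  qed
  moreover have "i \<noteq> j" using v(2) j by auto
  ultimately show ?thesis
    using i j v(2) unfolding m_def
    by (intro exI[of _ i] exI[of _ j] exI[of _ "\<lambda>l. c * x $ l"] exI[of _ "\<lambda>l. s * v $ l"])
      (simp add: c_def s_def)
qed

section \<open>Parametrisation of the degenerate tensors\<close>

text \<open>
  At \<open>(i, \<dots>, i)\<close> and \<open>(j, i, \<dots>, i)\<close> the coefficients of the two equations of a row form a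
  triangular matrix with unit diagonal when \<open>x\<^sub>i = 1\<close>, \<open>v\<^sub>i = 0\<close> and \<open>v\<^sub>j = 1\<close>. The two entries
  of the row at these positions can therefore be expressed by the others without division.
\<close>

definition pivot :: "nat \<Rightarrow> 'n \<Rightarrow> 'n list" where
  "pivot m i = replicate m i"

definition tangent_pivot :: "nat \<Rightarrow> 'n \<Rightarrow> 'n \<Rightarrow> 'n list" where
  "tangent_pivot m i j = j # replicate (m - 1) i"

lemma index_values_at_pivots:
  assumes "m > 0" "x i = 1" "v i = 0" "v j = 1"
  shows "index_monomial m x (pivot m i) = 1"
    and "index_derivative m x v (pivot m i) = 0"
    and "index_derivative m x v (tangent_pivot m i j) = 1"
proof -
  show "index_monomial m x (pivot m i) = 1" "index_derivative m x v (pivot m i) = 0"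
    using assms by (simp_all add: index_monomial_def index_derivative_def pivot_def)
  have nth: "tangent_pivot m i j ! p = (if p = 0 then j else i)" if "p < m" for p
    using that by (auto simp: tangent_pivot_def nth_Cons split: nat.split)
  have "index_derivative m x v (tangent_pivot m i j)
      = (\<Sum>p<m. if p = 0 then 1 else 0)"
    unfolding index_derivative_def
  proof (intro sum.cong refl)
    fix p assume "p \<in> {..<m}"
    \<comment> \<open>The summands with \<open>p > 0\<close> contain the factor \<open>v i = 0\<close>.\<close>
    have "(\<Prod>q\<in>{..<m} - {0}. x (tangent_pivot m i j ! q)) = 1"
      using assms by (intro prod.neutral) (auto simp: nth)
    then show "v (tangent_pivot m i j ! p) * (\<Prod>q\<in>{..<m} - {p}. x (tangent_pivot m i j ! q))
        = (if p = 0 then 1 else 0)"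
      using assms \<open>p \<in> {..<m}\<close> by (auto simp: nth)
  qed
  then show "index_derivative m x v (tangent_pivot m i j) = 1" using assms by simp
qed

text \<open>
  The kernel equation does not involve the entry at \<open>pivot m i\<close>, so it is solved for the entry at
  \<open>tangent_pivot m i j\<close> first; the eigenvector equation then gives the entry at \<open>pivot m i\<close>.
\<close>

definition solved_tangent_entry ::
  "nat \<Rightarrow> 'n \<Rightarrow> 'n \<Rightarrow> ('n::finite list \<Rightarrow> complex) \<Rightarrow> complex \<Rightarrow> ('n \<Rightarrow> complex) \<Rightarrow> ('n \<Rightarrow> complex)
    \<Rightarrow> 'n \<Rightarrow> complex" where
  "solved_tangent_entry m i j A lam x v r =
     lam * (of_nat m * x r ^ (m - 1) * v r)
     - (\<Sum>idx\<in>multi_indices m - {pivot m i, tangent_pivot m i j}.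
          A (r # idx) * index_derivative m x v idx)"

definition solved_entry ::
  "nat \<Rightarrow> 'n \<Rightarrow> 'n \<Rightarrow> ('n::finite list \<Rightarrow> complex) \<Rightarrow> complex \<Rightarrow> ('n \<Rightarrow> complex) \<Rightarrow> ('n \<Rightarrow> complex)
    \<Rightarrow> 'n \<Rightarrow> complex" where
  "solved_entry m i j A lam x v r =
     lam * x r ^ m
     - solved_tangent_entry m i j A lam x v r * index_monomial m x (tangent_pivot m i j)
     - (\<Sum>idx\<in>multi_indices m - {pivot m i, tangent_pivot m i j}.
          A (r # idx) * index_monomial m x idx)"

lemma finite_multi_indices: "finite (multi_indices k :: 'n::finite list set)"
  unfolding multi_indices_def using finite_lists_length_eq[of "UNIV :: 'n set" k] by simp

lemma degeneracy_equations_solved: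
  fixes A :: "'n::finite list \<Rightarrow> complex"
  assumes "m > 0" "i \<noteq> j" "x i = 1" "v i = 0" "v j = 1" and eqs: "degeneracy_equations m A lam x v"
  shows "A (r # tangent_pivot m i j) = solved_tangent_entry m i j A lam x v r"
    and "A (r # pivot m i) = solved_entry m i j A lam x v r"
proof -
  have pivots: "pivot m i \<in> multi_indices m" "tangent_pivot m i j \<in> multi_indices m"
      "pivot m i \<noteq> tangent_pivot m i j"
    using assms(1,2) by (auto simp: pivot_def tangent_pivot_def multi_indices_def
        dest: arg_cong[where f = hd] simp: hd_replicate)
  have split: "(\<Sum>idx\<in>multi_indices m. f idx) = f (pivot m i) + (f (tangent_pivot m i j)
      + (\<Sum>idx\<in>multi_indices m - {pivot m i, tangent_pivot m i j}. f idx))" for f :: "'n list \<Rightarrow> complex"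
  proof -
    have "(\<Sum>idx\<in>multi_indices m. f idx)
        = f (pivot m i) + (\<Sum>idx\<in>multi_indices m - {pivot m i}. f idx)"
      using pivots by (intro sum.remove finite_multi_indices)
    also have "(\<Sum>idx\<in>multi_indices m - {pivot m i}. f idx) = f (tangent_pivot m i j)
        + (\<Sum>idx\<in>multi_indices m - {pivot m i} - {tangent_pivot m i j}. f idx)"
      using pivots by (intro sum.remove finite_Diff finite_multi_indices) auto
    finally show ?thesis by (simp only: Diff_insert2[symmetric] insert_commute)
  qed
  note at_pivots = index_values_at_pivots[of m x i v j, OF assms(1) assms(3-5)]
  show tangent: "A (r # tangent_pivot m i j) = solved_tangent_entry m i j A lam x v r"
    using eqs unfolding degeneracy_equations_def solved_tangent_entry_def split
    by (simp add: at_pivots eq_diff_eq)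
  show "A (r # pivot m i) = solved_entry m i j A lam x v r"
    using eqs unfolding degeneracy_equations_def solved_entry_def split
    by (simp add: at_pivots tangent[symmetric] algebra_simps)
qed

text \<open>
  Solving the equations frees two entries in each row. These slots of \<open>b\<close> store the remaining
  parameters: \<open>lam\<close> in row \<open>i\<close> and \<open>x\<^sub>l\<close> in row \<open>l \<noteq> i\<close> of the first pivot, \<open>v\<^sub>l\<close> in row
  \<open>l \<notin> {i, j}\<close> of the second one. As \<open>v\<^sub>i = 0\<close>, nothing is stored at \<open>i # tangent_pivot m i j\<close>, so that
  the number of parameters is smaller than the number of entries of a tensor.
\<close>

definition degenerate_tensor ::
  "nat \<Rightarrow> 'n \<times> 'n \<Rightarrow> ('n::finite list \<Rightarrow> complex) \<Rightarrow> 'n list \<Rightarrow> complex" where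
  "degenerate_tensor m = (\<lambda>(i, j) b idx.
     let lam = b (i # pivot m i);
         x = (\<lambda>l. if l = i then 1 else b (l # pivot m i));
         v = (\<lambda>l. if l = i then 0 else if l = j then 1 else b (l # tangent_pivot m i j))
     in if tl idx = pivot m i then solved_entry m i j b lam x v (hd idx)
        else if tl idx = tangent_pivot m i j then solved_tangent_entry m i j b lam x v (hd idx)
        else b idx)"

lemma coordinatewise_polynomial_degenerate_tensor:
  "coordinatewise_polynomial (\<lambda>b. degenerate_tensor m \<kappa> b idx)"
  unfolding degenerate_tensor_def Let_def case_prod_beta solved_entry_def
    solved_tangent_entry_def index_monomial_def index_derivative_def
  by (intro coordinatewise_polynomial_intros)

lemma degenerate_tensor_attained:
  fixes A :: "'n::finite list \<Rightarrow> complex"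
  assumes "k \<ge> 2" "i \<noteq> j" "x i = 1" "v i = 0" "v j = 1"
    and eqs: "degeneracy_equations (k - 1) A lam x v"
  shows "\<exists>b\<in>affine_space (multi_indices k - {i # tangent_pivot (k - 1) i j}).
    \<forall>idx\<in>multi_indices k. A idx = degenerate_tensor (k - 1) (i, j) b idx"
proof -
  define m where "m = k - 1"
  have m: "m > 0" "k = Suc m" using assms by (auto simp: m_def)
  have pivots: "length (pivot m i) = m" "length (tangent_pivot m i j) = m"
      "pivot m i \<noteq> tangent_pivot m i j"
    using assms(2) m(1) by (auto simp: pivot_def tangent_pivot_def
        dest: arg_cong[where f = hd] simp: hd_replicate)
  define J where "J = multi_indices k - {i # tangent_pivot m i j}"
  define b where "b = restrict (\<lambda>idx.
      if tl idx = pivot m i then (if hd idx = i then lam else x (hd idx))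
      else if tl idx = tangent_pivot m i j then v (hd idx) else A idx) J"
  have b_pivot: "b (l # pivot m i) = (if l = i then lam else x l)" for l
    using pivots m by (auto simp: b_def J_def multi_indices_def)
  have b_tangent: "b (l # tangent_pivot m i j) = v l" if "l \<noteq> i" for l
    using pivots m that by (auto simp: b_def J_def multi_indices_def)
  have b_other: "b (r # idx) = A (r # idx)"
    if "idx \<in> multi_indices m - {pivot m i, tangent_pivot m i j}" for r idx
    using that m by (auto simp: b_def J_def multi_indices_def)
  have x: "(\<lambda>l. if l = i then 1 else b (l # pivot m i)) = x"
    using assms by (auto simp: b_pivot)
  have v: "(\<lambda>l. if l = i then 0 else if l = j then 1 else b (l # tangent_pivot m i j)) = v"
    using assms by (auto simp: b_tangent)
  have lam: "b (i # pivot m i) = lam" by (simp add: b_pivot)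
  have entries: "solved_tangent_entry m i j b lam x v r = solved_tangent_entry m i j A lam x v r"
      "solved_entry m i j b lam x v r = solved_entry m i j A lam x v r" for r
    unfolding solved_entry_def solved_tangent_entry_def by (simp_all only: b_other cong: sum.cong)
  have "A idx = degenerate_tensor m (i, j) b idx" if idx_k: "idx \<in> multi_indices k" for idx
  proof -
    obtain r rest where idx: "idx = r # rest" "rest \<in> multi_indices m"
      using idx_k m by (auto simp: multi_indices_def length_Suc_conv)
    show ?thesis
      using degeneracy_equations_solved[OF m(1) assms(2-5) eqs[folded m_def], of r] idx b_other[of rest r]
      by (auto simp: degenerate_tensor_def x v lam entries Let_def)
  qed
  moreover have "b \<in> affine_space J" by (simp add: b_def affine_space_def)
  ultimately show ?thesis unfolding m_def[symmetric] J_def by blast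
qed

theorem theorem5p4:
  fixes k :: nat
  assumes "k \<ge> 3"
  shows "generic (multi_indices k)
           (\<lambda>A :: 'n::finite list \<Rightarrow> complex.
              \<forall>lam x. eigenpair k A lam x \<longrightarrow> nondegenerate_eigenvector k A lam x)"
proof (rule generic_if_exceptions_parametrised[where K = UNIV and \<Phi> = "degenerate_tensor (k - 1)"
      and J = "\<lambda>(i, j). multi_indices k - {i # tangent_pivot (k - 1) i j}"])
  fix \<kappa> :: "'n \<times> 'n"
  obtain i j where \<kappa>: "\<kappa> = (i, j)" by fastforce
  have "i # tangent_pivot (k - 1) i j \<in> multi_indices k"
    using assms by (simp add: multi_indices_def tangent_pivot_def)
  then show "card (case \<kappa> of (i, j) \<Rightarrow> multi_indices k - {i # tangent_pivot (k - 1) i j})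
      < card (multi_indices k :: 'n list set)"
    unfolding \<kappa> by (simp only: case_prod_conv) (rule card_Diff1_less[OF finite_multi_indices])
next
  fix A :: "'n list \<Rightarrow> complex"
  assume "\<not> (\<forall>lam x. eigenpair k A lam x \<longrightarrow> nondegenerate_eigenvector k A lam x)"
  then obtain lam x where "eigenpair k A lam x" "\<not> nondegenerate_eigenvector k A lam x" by blast
  then obtain i j y v where "i \<noteq> j" "y i = 1" "v i = 0" "v j = 1" "degeneracy_equations (k - 1) A lam y v"
    using degenerate_eigenvector_normal_form[of k A lam x] assms by auto
  then have "\<exists>b\<in>affine_space (multi_indices k - {i # tangent_pivot (k - 1) i j}).
      \<forall>idx\<in>multi_indices k. A idx = degenerate_tensor (k - 1) (i, j) b idx"
    using assms by (intro degenerate_tensor_attained) auto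
  then show "\<exists>\<kappa>\<in>UNIV. \<exists>b\<in>affine_space (case \<kappa> of (i, j) \<Rightarrow> multi_indices k - {i # tangent_pivot (k - 1) i j}).
      \<forall>idx\<in>multi_indices k. A idx = degenerate_tensor (k - 1) \<kappa> b idx"
    by (intro bexI[of _ "(i, j)"]) auto
qed (auto simp: finite_multi_indices intro: coordinatewise_polynomial_degenerate_tensor)

end
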